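(* Let $\Delta_1,\ldots,\Delta_6\subset[0,1]^3$ be the six standard Kuhn tetrahedra (listed in the context), let $\mathbf x_1,\ldots,\mathbf x_6\in\mathbb R^3$ be arbitrary vectors, and let $$K=\operatorname{conv}\bigcup_{i=1}^6(\Delta_i+\mathbf x_i).$$ Then $K+\mathbb Z^3=\mathbb R^3$.
   Context: Label the vertices of the cube $[0,1]^3$ by $\mathbf a=(0,0,0)$, $\mathbf b=(1,0,0)$, $\mathbf c=(1,1,0)$, $\mathbf d=(0,1,0)$, $\mathbf e=(0,0,1)$, $\mathbf f=(1,0,1)$, $\mathbf g=(1,1,1)$, $\mathbf h=(0,1,1)$. The six Kuhn tetrahedra are $\Delta_1=\operatorname{conv}\{\mathbf a,\mathbf b,\mathbf c,\mathbf g\}$, $\Delta_2=\operatorname{conv}\{\mathbf a,\mathbf b,\mathbf f,\mathbf g\}$, $\Delta_3=\operatorname{conv}\{\mathbf a,\mathbf e,\mathbf f,\mathbf g\}$, $\Delta_4=\operatorname{conv}\{\mathbf a,\mathbf e,\mathbf h,\mathbf g\}$, $\Delta_5=\operatorname{conv}\{\mathbf a,\mathbf d,\mathbf h,\mathbf g\}$, $\Delta_6=\operatorname{conv}\{\mathbf a,\mathbf d,\mathbf c,\mathbf g\}$. Here $K+\mathbb Z^3=\{\mathbf k+\mathbf z:\mathbf k\in K,\ \mathbf z\in\mathbb Z^3\}$. *)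

theory Defs
  imports "HOL-Analysis.Analysis"
begin

definition vert_a :: "real^3" where "vert_a = vector [0, 0, 0]"
definition vert_b :: "real^3" where "vert_b = vector [1, 0, 0]"
definition vert_c :: "real^3" where "vert_c = vector [1, 1, 0]"
definition vert_d :: "real^3" where "vert_d = vector [0, 1, 0]"
definition vert_e :: "real^3" where "vert_e = vector [0, 0, 1]"
definition vert_f :: "real^3" where "vert_f = vector [1, 0, 1]"
definition vert_g :: "real^3" where "vert_g = vector [1, 1, 1]"
definition vert_h :: "real^3" where "vert_h = vector [0, 1, 1]"

text \<open>Tetrahedra are numbered from 1 to 6; other indices are junk and never used.\<close>

definition kuhn_tetrahedron :: "nat \<Rightarrow> (real^3) set" where
  "kuhn_tetrahedron i =
    (if i = 1 then convex hull {vert_a, vert_b, vert_c, vert_g}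
     else if i = 2 then convex hull {vert_a, vert_b, vert_f, vert_g}
     else if i = 3 then convex hull {vert_a, vert_e, vert_f, vert_g}
     else if i = 4 then convex hull {vert_a, vert_e, vert_h, vert_g}
     else if i = 5 then convex hull {vert_a, vert_d, vert_h, vert_g}
     else if i = 6 then convex hull {vert_a, vert_d, vert_c, vert_g}
     else {})"

definition integer_lattice :: "(real^3) set" where
  "integer_lattice = {z. \<forall>j. z $ j \<in> \<int>}"

end

theory Submission
  imports Defs
begin

text \<open>
  Fix a point \<open>q\<close>. Replacing \<open>K\<close> by \<open>K - q\<close>, which is again a compact convex set containing a translate
  of each Kuhn tetrahedron, it suffices to find a lattice point in \<open>K\<close>.

  Suppose there is none, and let \<open>c v \<noteq> v\<close> be the point of \<open>K\<close> nearest to the lattice point \<open>v\<close>.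
  The lattice translates of the six tetrahedra triangulate space. Interpolating the values \<open>c v\<close>
  linearly on each tetrahedron gives a continuous map of \<open>K\<close> into itself, which has a fixed point \<open>p\<close>
  by Brouwer's theorem. Since the same interpolation reproduces \<open>p\<close> from the lattice points
  themselves, the vectors \<open>v - c v\<close>, with \<open>v\<close> ranging over the vertices of the tetrahedron
  \<open>\<Delta>\<close> around \<open>p\<close>, have a convex combination equal to 0.

  On the other hand some translate \<open>\<Delta> + t\<close> lies in \<open>K\<close>. For a vertex \<open>v\<close> of \<open>\<Delta>\<close> the point \<open>v + t\<close>
  of \<open>K\<close> lies behind the hyperplane through \<open>c v\<close> with normal \<open>v - c v\<close>, while \<open>v\<close> lies
  strictly beyond it; hence \<open>(v - c v) \<bullet> t < 0\<close>. Thus all the \<open>v - c v\<close> lie in one open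
  half-space, and 0 cannot be a convex combination of them.

  The argument from Brouwer's theorem is \<open>convex_meets_nodes_of_fitting_interpolation\<close>, valid for
  any interpolation scheme in any dimension. That the Kuhn triangulation supplies such a scheme is
  \<open>kuhn_interpolation\<close>. Its proof uses explicit barycentric weights, whose continuity and support
  can be read off a formula.
\<close>

section \<open>Interpolation and nearest points\<close>

text \<open>
  The functions \<open>\<beta> v\<close> are the weights of an interpolation scheme with nodes \<open>V\<close> that is exact on the
  identity. The contradiction comes from pairing the relation \<open>\<Sum>v\<in>V. \<beta> v p *\<^sub>R (v - c v) = 0\<close> at
  a fixed point \<open>p\<close> of the interpolated nearest-point map with the translation \<open>t\<close> that moves
  the nodes active at \<open>p\<close> into \<open>K\<close>.
\<close>

lemma convex_meets_nodes_of_fitting_interpolation: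
  fixes K :: "'a::euclidean_space set" and \<beta> :: "'a \<Rightarrow> 'a \<Rightarrow> real"
  assumes K: "compact K" "convex K" "K \<noteq> {}" and "finite V"
    and cont: "\<And>v. v \<in> V \<Longrightarrow> continuous_on K (\<beta> v)"
    and nonneg: "\<And>v p. v \<in> V \<Longrightarrow> p \<in> K \<Longrightarrow> 0 \<le> \<beta> v p"
    and total: "\<And>p. p \<in> K \<Longrightarrow> (\<Sum>v\<in>V. \<beta> v p) = 1"
    and bary: "\<And>p. p \<in> K \<Longrightarrow> (\<Sum>v\<in>V. \<beta> v p *\<^sub>R v) = p"
    and fits: "\<And>p. p \<in> K \<Longrightarrow> \<exists>t. \<forall>v\<in>V. 0 < \<beta> v p \<longrightarrow> v + t \<in> K"
  shows "\<exists>v\<in>V. v \<in> K"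
proof (rule ccontr)
  assume "\<not> ?thesis"
  then have out: "v \<notin> K" if "v \<in> V" for v using that by blast
  have "closed K" using K(1) by (rule compact_imp_closed)
  define c where "c = closest_point K"
  have cK: "c v \<in> K" for v
    unfolding c_def using \<open>closed K\<close> K(3) by (rule closest_point_in_set)
  define g where "g p = (\<Sum>v\<in>V. \<beta> v p *\<^sub>R c v)" for p
  have "continuous_on K g"
    unfolding g_def by (intro continuous_intros cont)
  moreover have "g \<in> K \<rightarrow> K"
    unfolding g_def using K(2) \<open>finite V\<close> total nonneg cK by (auto intro!: convex_sum)
  ultimately obtain p where "p \<in> K" and p: "g p = p"
    using brouwer[OF K] by blast
  have balance: "(\<Sum>v\<in>V. \<beta> v p *\<^sub>R (v - c v)) = 0"
    using p bary[OF \<open>p \<in> K\<close>] by (simp add: g_def scaleR_diff_right sum_subtractf)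
  obtain t where t: "\<And>v. v \<in> V \<Longrightarrow> 0 < \<beta> v p \<Longrightarrow> v + t \<in> K"
    using fits[OF \<open>p \<in> K\<close>] by blast
  \<comment> \<open>Nearest points give \<open>(v - c v) \<bullet> (v + t - c v) \<le> 0\<close>, and \<open>v \<noteq> c v\<close> makes the part
    \<open>(v - c v) \<bullet> (v - c v)\<close> of it positive.\<close>
  have descent: "(v - c v) \<bullet> t < 0" if v: "v \<in> V" "0 < \<beta> v p" for v
  proof -
    have "(v - c v) \<bullet> ((v + t) - c v) \<le> 0"
      unfolding c_def using K(2) \<open>closed K\<close> t[OF v] by (rule closest_point_dot)
    moreover have "v + t - c v = (v - c v) + t" by simp
    moreover have "0 < (v - c v) \<bullet> (v - c v)"
      using out[OF v(1)] cK[of v] by auto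
    ultimately show ?thesis by (simp only: inner_add_right)
  qed
  obtain u where "u \<in> V" "0 < \<beta> u p"
  proof -
    have "\<exists>u\<in>V. \<beta> u p \<noteq> 0"
      using total[OF \<open>p \<in> K\<close>] by (metis sum.neutral zero_neq_one)
    with nonneg[OF _ \<open>p \<in> K\<close>] that show ?thesis by force
  qed
  have "(\<Sum>v\<in>V. \<beta> v p * ((v - c v) \<bullet> t)) < (\<Sum>v\<in>V. 0)"
  proof (rule sum_strict_mono_ex1[OF \<open>finite V\<close>])
    show "\<forall>v\<in>V. \<beta> v p * ((v - c v) \<bullet> t) \<le> 0"
      using descent nonneg[OF _ \<open>p \<in> K\<close>]
      by (metis less_eq_real_def mult_nonneg_nonpos mult_zero_left order_refl)
    show "\<exists>v\<in>V. \<beta> v p * ((v - c v) \<bullet> t) < 0"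
      using descent \<open>u \<in> V\<close> \<open>0 < \<beta> u p\<close> mult_pos_neg by blast
  qed
  moreover have "(\<Sum>v\<in>V. \<beta> v p * ((v - c v) \<bullet> t)) = (\<Sum>v\<in>V. \<beta> v p *\<^sub>R (v - c v)) \<bullet> t"
    by (simp add: inner_sum_left)
  ultimately show False by (simp add: balance)
qed

section \<open>Barycentric weights of the Kuhn triangulation\<close>

text \<open>
  With \<open>d = v - p\<close> this is the length of the set of all \<open>s \<in> [0, 1)\<close> such that rounding down every
  coordinate of \<open>p + (s, s, s)\<close> gives \<open>v\<close>: coordinate \<open>m\<close> requires \<open>d $ m \<le> s < 1 + d $ m\<close>. As \<open>s\<close> grows,
  the coordinates of the rounded point jump in decreasing order of the fractional parts of \<open>p\<close>,
  so it runs through vertices of a single Kuhn tetrahedron; its average over \<open>s\<close> is \<open>p\<close>.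
  So these lengths are the barycentric coordinates of \<open>p\<close>, in a form visibly continuous in \<open>p\<close>.
\<close>

definition kuhn_hat :: "real^3 \<Rightarrow> real" where
  "kuhn_hat d = max 0 (min (min 1 (1 + d $ 1)) (min (1 + d $ 2) (1 + d $ 3))
                        - max (max 0 (d $ 1)) (max (d $ 2) (d $ 3)))"

lemma kuhn_hat_nonneg: "0 \<le> kuhn_hat d"
  by (simp add: kuhn_hat_def)

lemma continuous_on_kuhn_hat: "continuous_on S (\<lambda>p. kuhn_hat (v - p))"
  unfolding kuhn_hat_def by (intro continuous_intros)

lemma kuhn_hat_pos_iff:
  "0 < kuhn_hat d \<longleftrightarrow> (\<forall>m. \<bar>d $ m\<bar> < 1) \<and> (\<forall>m n. d $ m < 1 + d $ n)"
proof -
  have "0 < kuhn_hat d \<longleftrightarrow> max (max 0 (d $ 1)) (max (d $ 2) (d $ 3))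
      < min (min 1 (1 + d $ 1)) (min (1 + d $ 2) (1 + d $ 3))"
    unfolding kuhn_hat_def by (simp only: less_max_iff_disj diff_gt_0_iff_gt) simp
  then show ?thesis unfolding forall_3 max_less_iff_conj min_less_iff_conj by auto
qed

text \<open>
  The tetrahedron containing \<open>p\<close> is determined by the order of the fractional parts of its
  coordinates. Letting \<open>i, j, k\<close> be the three indices in an arbitrary order treats the six
  tetrahedra at once; they are told apart only in \<open>kuhn_chain_in_tetrahedron\<close>.
\<close>

context
  fixes i j k :: 3
  assumes ijk: "{i, j, k} = UNIV"
begin

lemma distinct_indices: "i \<noteq> j" "i \<noteq> k" "j \<noteq> k"
proof -
  have "card {i, j, k} = 3" using ijk by simp
  then show "i \<noteq> j" "i \<noteq> k" "j \<noteq> k" by (auto simp: card_insert_if split: if_splits)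
qed

lemma index_cases:
  obtains "i = 1" "j = 2" "k = 3" | "i = 1" "j = 3" "k = 2" | "i = 3" "j = 1" "k = 2"
    | "i = 3" "j = 2" "k = 1" | "i = 2" "j = 3" "k = 1" | "i = 2" "j = 1" "k = 3"
  using exhaust_3[of i] exhaust_3[of j] exhaust_3[of k] distinct_indices by blast

lemma kuhn_hat_ijk:
  "kuhn_hat d = max 0 (min (min 1 (1 + d $ i)) (min (1 + d $ j) (1 + d $ k))
                       - max (max 0 (d $ i)) (max (d $ j) (d $ k)))"
  by (cases rule: index_cases)
    (simp_all add: kuhn_hat_def min.commute min.left_commute min.assoc
      max.commute max.left_commute max.assoc)

lemma vec_eq_ijk: "a = b \<longleftrightarrow> a $ i = b $ i \<and> a $ j = b $ j \<and> a $ k = b $ k" for a b :: "'a^3"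
proof -
  have "m \<in> {i, j, k}" for m using ijk by simp
  then show ?thesis unfolding vec_eq_iff by (metis insertE singletonD)
qed

context
  fixes p w :: "real^3"
  assumes order: "frac (p $ i) \<ge> frac (p $ j)" "frac (p $ j) \<ge> frac (p $ k)"
    and w: "w = (\<chi> m. of_int \<lfloor>p $ m\<rfloor>)"
begin

text \<open>
  A lattice point of positive weight is a corner of the unit cube around \<open>p\<close>, and its raised
  coordinates are closed under passing to larger fractional parts. With the order
  \<open>i, j, k\<close> this leaves four of the eight corners.
\<close>

lemma lattice_point_in_kuhn_support:
  assumes "v \<in> integer_lattice" "0 < kuhn_hat (v - p)"
  shows "v \<in> {w, w + axis i 1, w + axis i 1 + axis j 1, w + axis i 1 + axis j 1 + axis k 1}"
proof -
  have corner: "v $ m = w $ m \<or> v $ m = w $ m + 1" for m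
  proof -
    obtain a where a: "v $ m = of_int a"
      using assms(1) by (auto simp: integer_lattice_def elim: Ints_cases)
    have "\<bar>v $ m - p $ m\<bar> < 1" using assms(2) unfolding kuhn_hat_pos_iff by simp
    then have "a = \<lfloor>p $ m\<rfloor> \<or> a = \<lfloor>p $ m\<rfloor> + 1" unfolding a by linarith
    then show ?thesis by (auto simp: a w)
  qed
  have upper: "v $ m = w $ m + 1" if "frac (p $ n) \<le> frac (p $ m)" "v $ n = w $ n + 1" for m n
  proof -
    have "v $ n - p $ n < 1 + (v $ m - p $ m)"
      using assms(2) unfolding kuhn_hat_pos_iff by simp
    with that corner[of m] show ?thesis by (auto simp: w frac_def)
  qed
  consider "v $ i = w $ i" "v $ j = w $ j" "v $ k = w $ k"
    | "v $ i = w $ i + 1" "v $ j = w $ j" "v $ k = w $ k"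
    | "v $ i = w $ i + 1" "v $ j = w $ j + 1" "v $ k = w $ k"
    | "v $ i = w $ i + 1" "v $ j = w $ j + 1" "v $ k = w $ k + 1"
    using corner[of i] corner[of j] corner[of k] upper[OF order(1)] upper[OF order(2)] by metis
  then show ?thesis
    using distinct_indices by cases (simp_all add: vec_eq_ijk axis_def)
qed

lemma kuhn_hat_on_chain:
  "kuhn_hat (w - p) = 1 - frac (p $ i)"
  "kuhn_hat (w + axis i 1 - p) = frac (p $ i) - frac (p $ j)"
  "kuhn_hat (w + axis i 1 + axis j 1 - p) = frac (p $ j) - frac (p $ k)"
  "kuhn_hat (w + axis i 1 + axis j 1 + axis k 1 - p) = frac (p $ k)"
proof -
  have w_minus_p: "(w - p) $ m = - frac (p $ m)" for m by (simp add: w frac_def)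
  have coords: "(w + u - p) $ m = u $ m - frac (p $ m)" for u m by (simp add: w frac_def)
  have coords2: "(w + u + u' - p) $ m = u $ m + u' $ m - frac (p $ m)" for u u' m
    by (simp add: w frac_def)
  have coords3: "(w + u + u' + u'' - p) $ m = u $ m + u' $ m + u'' $ m - frac (p $ m)"
    for u u' u'' m by (simp add: w frac_def)
  have axes: "axis n 1 $ n = (1 :: real)" "n \<noteq> m \<Longrightarrow> axis n 1 $ m = (0 :: real)" for n m :: 3
    by (simp_all add: axis_def)
  note axis_ijk = axes(1) distinct_indices[THEN axes(2)]
    distinct_indices[THEN not_sym, THEN axes(2)]
  have r: "0 \<le> frac (p $ k)" "frac (p $ i) < 1" by (simp_all add: frac_lt_1)
  show "kuhn_hat (w - p) = 1 - frac (p $ i)"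
    using order r unfolding kuhn_hat_ijk w_minus_p by linarith
  show "kuhn_hat (w + axis i 1 - p) = frac (p $ i) - frac (p $ j)"
    using order r unfolding kuhn_hat_ijk coords axis_ijk by linarith
  show "kuhn_hat (w + axis i 1 + axis j 1 - p) = frac (p $ j) - frac (p $ k)"
    using order r unfolding kuhn_hat_ijk coords2 axis_ijk by linarith
  show "kuhn_hat (w + axis i 1 + axis j 1 + axis k 1 - p) = frac (p $ k)"
    using order r unfolding kuhn_hat_ijk coords3 axis_ijk by linarith
qed

text \<open>
  The function \<open>f\<close> is left arbitrary because two instances are needed: constant 1 shows
  that the weights sum to 1, and the identity shows that they reproduce \<open>p\<close>.
\<close>

lemma sum_kuhn_hat:
  fixes f :: "real^3 \<Rightarrow> 'a::real_vector"
  assumes "finite V" "V \<subseteq> integer_lattice"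
    and supp: "\<And>v. v \<in> integer_lattice \<Longrightarrow> 0 < kuhn_hat (v - p) \<Longrightarrow> v \<in> V"
  shows "(\<Sum>v\<in>V. kuhn_hat (v - p) *\<^sub>R f v) =
      (1 - frac (p $ i)) *\<^sub>R f w
    + (frac (p $ i) - frac (p $ j)) *\<^sub>R f (w + axis i 1)
    + (frac (p $ j) - frac (p $ k)) *\<^sub>R f (w + axis i 1 + axis j 1)
    + frac (p $ k) *\<^sub>R f (w + axis i 1 + axis j 1 + axis k 1)"
proof -
  let ?C = "{w, w + axis i 1, w + axis i 1 + axis j 1, w + axis i 1 + axis j 1 + axis k 1}"
  have C: "?C \<subseteq> integer_lattice" by (auto simp: integer_lattice_def w axis_def)
  have zero: "kuhn_hat (v - p) = 0" if "\<not> 0 < kuhn_hat (v - p)" for v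
    using that kuhn_hat_nonneg[of "v - p"] by simp
  have "(\<Sum>v\<in>V. kuhn_hat (v - p) *\<^sub>R f v) = (\<Sum>v\<in>?C. kuhn_hat (v - p) *\<^sub>R f v)"
  proof (rule sum.mono_neutral_cong)
    show "kuhn_hat (v - p) *\<^sub>R f v = 0" if "v \<in> ?C - V" for v
    proof -
      have "\<not> 0 < kuhn_hat (v - p)" using that C supp by blast
      then have "kuhn_hat (v - p) = 0" by (rule zero)
      then show ?thesis by simp
    qed
    show "kuhn_hat (v - p) *\<^sub>R f v = 0" if "v \<in> V - ?C" for v
    proof -
      have "\<not> 0 < kuhn_hat (v - p)" using that assms(2) lattice_point_in_kuhn_support by blast
      then have "kuhn_hat (v - p) = 0" by (rule zero)
      then show ?thesis by simp
    qed
    show "finite ?C" by (intro finite.intros)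
  qed (rule \<open>finite V\<close>, rule refl)
  also have "\<dots> =
      kuhn_hat (w - p) *\<^sub>R f w + kuhn_hat (w + axis i 1 - p) *\<^sub>R f (w + axis i 1)
    + kuhn_hat (w + axis i 1 + axis j 1 - p) *\<^sub>R f (w + axis i 1 + axis j 1)
    + kuhn_hat (w + axis i 1 + axis j 1 + axis k 1 - p) *\<^sub>R f (w + axis i 1 + axis j 1 + axis k 1)"
  proof -
    have four: "sum h {a, b, c, d} = h a + h b + h c + h d"
      if "a \<notin> {b, c, d}" "b \<notin> {c, d}" "c \<noteq> d"
      for a b c d :: "real^3" and h :: "real^3 \<Rightarrow> 'a"
      using that by (simp add: add.assoc)
    show ?thesis
      by (rule four) (use distinct_indices in \<open>simp_all add: vec_eq_ijk axis_def\<close>)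
  qed
  finally show ?thesis unfolding kuhn_hat_on_chain .
qed

end

lemma kuhn_chain_in_tetrahedron:
  "\<exists>n\<in>{1..6}. {0, axis i 1, axis i 1 + axis j 1, axis i 1 + axis j 1 + axis k 1}
     \<subseteq> kuhn_tetrahedron n"
proof -
  have verts: "vert_a = 0" "vert_b = axis 1 1" "vert_d = axis 2 1" "vert_e = axis 3 1"
    "vert_c = axis 1 1 + axis 2 1" "vert_f = axis 1 1 + axis 3 1" "vert_h = axis 2 1 + axis 3 1"
    "vert_g = axis 1 1 + axis 2 1 + axis 3 1"
    by (simp_all add: vec_eq_iff forall_3 axis_def vert_a_def vert_b_def vert_c_def vert_d_def
        vert_e_def vert_f_def vert_g_def vert_h_def)
  show ?thesis
  proof (cases rule: index_cases)
    case 1 then show ?thesis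
      by (intro bexI[of _ 1]) (simp_all add: kuhn_tetrahedron_def verts hull_inc ac_simps)
  next
    case 2 then show ?thesis
      by (intro bexI[of _ 2]) (simp_all add: kuhn_tetrahedron_def verts hull_inc ac_simps)
  next
    case 3 then show ?thesis
      by (intro bexI[of _ 3]) (simp_all add: kuhn_tetrahedron_def verts hull_inc ac_simps)
  next
    case 4 then show ?thesis
      by (intro bexI[of _ 4]) (simp_all add: kuhn_tetrahedron_def verts hull_inc ac_simps)
  next
    case 5 then show ?thesis
      by (intro bexI[of _ 5]) (simp_all add: kuhn_tetrahedron_def verts hull_inc ac_simps)
  next
    case 6 then show ?thesis
      by (intro bexI[of _ 6]) (simp_all add: kuhn_tetrahedron_def verts hull_inc ac_simps)
  qed
qed

end

text \<open>
  The last claim is what links the weights to the tetrahedra: the lattice points active at \<open>p\<close>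
  come, up to the translation \<open>w\<close>, from a single \<open>kuhn_tetrahedron n\<close>, so that they can be
  moved together into any set containing a translate of that tetrahedron.
\<close>

lemma kuhn_interpolation:
  fixes p :: "real^3"
  assumes V: "finite V" "V \<subseteq> integer_lattice"
    and supp: "\<And>v. v \<in> integer_lattice \<Longrightarrow> 0 < kuhn_hat (v - p) \<Longrightarrow> v \<in> V"
  shows "(\<Sum>v\<in>V. kuhn_hat (v - p)) = 1"
    and "(\<Sum>v\<in>V. kuhn_hat (v - p) *\<^sub>R v) = p"
    and "\<exists>n\<in>{1..6}. \<exists>w. \<forall>v\<in>V. 0 < kuhn_hat (v - p) \<longrightarrow> v - w \<in> kuhn_tetrahedron n"
proof -
  obtain i j k :: 3 where ijk: "{i, j, k} = UNIV"
    and order: "frac (p $ i) \<ge> frac (p $ j)" "frac (p $ j) \<ge> frac (p $ k)"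
  proof -
    have "UNIV = {1, 2, 3 :: 3}" using exhaust_3 by auto
    then have "{1, 2, 3} = (UNIV :: 3 set)" "{1, 3, 2} = (UNIV :: 3 set)"
      "{2, 1, 3} = (UNIV :: 3 set)" "{2, 3, 1} = (UNIV :: 3 set)"
      "{3, 1, 2} = (UNIV :: 3 set)" "{3, 2, 1} = (UNIV :: 3 set)" by auto
    with that show ?thesis by (meson linear)
  qed
  define w :: "real^3" where w: "w = (\<chi> m. of_int \<lfloor>p $ m\<rfloor>)"
  note sum = sum_kuhn_hat[OF ijk order w V supp]
  show "(\<Sum>v\<in>V. kuhn_hat (v - p)) = 1"
    using sum[of "\<lambda>_. 1 :: real"] by simp
  have "(\<Sum>v\<in>V. kuhn_hat (v - p) *\<^sub>R v) =
      w + frac (p $ i) *\<^sub>R axis i 1 + frac (p $ j) *\<^sub>R axis j 1 + frac (p $ k) *\<^sub>R axis k 1"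
    using sum[of "\<lambda>v. v"] by (simp add: algebra_simps)
  also have "\<dots> = p"
    unfolding vec_eq_ijk[OF ijk] using distinct_indices[OF ijk]
    by (simp add: w axis_def frac_def)
  finally show "(\<Sum>v\<in>V. kuhn_hat (v - p) *\<^sub>R v) = p" .
  obtain n where n: "n \<in> {1..6}"
    "{0, axis i 1, axis i 1 + axis j 1, axis i 1 + axis j 1 + axis k 1} \<subseteq> kuhn_tetrahedron n"
    using kuhn_chain_in_tetrahedron[OF ijk] by blast
  have "v - w \<in> kuhn_tetrahedron n" if "v \<in> V" "0 < kuhn_hat (v - p)" for v
  proof -
    have "v \<in> integer_lattice" using that V by blast
    from lattice_point_in_kuhn_support[OF ijk order w this that(2)] n(2)
    show ?thesis by (auto simp: add.assoc)
  qed
  with n(1) show "\<exists>n\<in>{1..6}. \<exists>w. \<forall>v\<in>V. 0 < kuhn_hat (v - p) \<longrightarrow> v - w \<in> kuhn_tetrahedron n"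
    by blast
qed

section \<open>The lattice meets every compact convex set that contains Kuhn translates\<close>

lemma finite_bounded_integer_lattice:
  assumes "bounded S"
  shows "finite (integer_lattice \<inter> S)"
proof -
  obtain B where B: "\<And>z. z \<in> S \<Longrightarrow> norm z \<le> B"
    using assms by (auto simp: bounded_iff)
  let ?A = "{a \<in> \<int>. \<bar>a\<bar> \<le> B}"
  have "integer_lattice \<inter> S \<subseteq> vec_lambda ` (UNIV \<rightarrow>\<^sub>E ?A)"
  proof
    fix z assume z: "z \<in> integer_lattice \<inter> S"
    have "\<bar>z $ m\<bar> \<le> B" for m
      using z B[of z] component_le_norm_cart[of z m] by simp
    with z have "vec_nth z \<in> UNIV \<rightarrow>\<^sub>E ?A" by (auto simp: integer_lattice_def)
    then show "z \<in> vec_lambda ` (UNIV \<rightarrow>\<^sub>E ?A)"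
      by (intro image_eqI[of z vec_lambda "vec_nth z"]) simp_all
  qed
  moreover have "finite (UNIV \<rightarrow>\<^sub>E ?A :: (3 \<Rightarrow> real) set)"
    by (intro finite_PiE finite_abs_int_segment) simp
  ultimately show ?thesis by (rule finite_subset[OF _ finite_imageI])
qed

lemma lattice_point_in_convex_with_kuhn_translates:
  fixes K :: "(real^3) set"
  assumes K: "compact K" "convex K"
    and translates: "\<And>n. n \<in> {1..6} \<Longrightarrow> \<exists>t. \<forall>u\<in>kuhn_tetrahedron n. u + t \<in> K"
  shows "\<exists>z\<in>integer_lattice. z \<in> K"
proof -
  have "vert_a \<in> kuhn_tetrahedron 1" by (simp add: kuhn_tetrahedron_def hull_inc)
  with translates[of 1] have "K \<noteq> {}" by auto
  obtain R where R: "\<And>p. p \<in> K \<Longrightarrow> norm p \<le> R"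
    using compact_imp_bounded[OF K(1)] by (auto simp: bounded_iff)
  \<comment> \<open>Lattice points active at a point of \<open>K\<close> differ from it by less than 1 in each of the three
    coordinates, so they lie within distance 3 of it.\<close>
  define V where "V = integer_lattice \<inter> cball 0 (R + 3)"
  have V: "finite V" "V \<subseteq> integer_lattice"
    unfolding V_def by (auto intro: finite_bounded_integer_lattice)
  have supp: "v \<in> V" if "p \<in> K" "v \<in> integer_lattice" "0 < kuhn_hat (v - p)" for v p
  proof -
    have "norm (v - p) \<le> (\<Sum>m\<in>UNIV. \<bar>(v - p) $ m\<bar>)" by (rule norm_le_l1_cart)
    also have "\<dots> \<le> (\<Sum>m\<in>(UNIV :: 3 set). 1)"
      using that(3) unfolding kuhn_hat_pos_iff by (intro sum_mono) (simp add: less_imp_le)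
    finally have "norm v \<le> R + 3"
      using R[OF that(1)] norm_triangle_sub[of v p] by simp
    with that(2) show ?thesis by (simp add: V_def)
  qed
  have "\<exists>v\<in>V. v \<in> K"
  proof (rule convex_meets_nodes_of_fitting_interpolation
      [OF K \<open>K \<noteq> {}\<close> V(1), where \<beta> = "\<lambda>v p. kuhn_hat (v - p)"])
    fix p assume p: "p \<in> K"
    note interp = kuhn_interpolation[OF V supp[OF p]]
    show "(\<Sum>v\<in>V. kuhn_hat (v - p)) = 1" by (rule interp(1))
    show "(\<Sum>v\<in>V. kuhn_hat (v - p) *\<^sub>R v) = p" by (rule interp(2))
    obtain n w where n: "n \<in> {1..6}"
      and w: "\<And>v. v \<in> V \<Longrightarrow> 0 < kuhn_hat (v - p) \<Longrightarrow> v - w \<in> kuhn_tetrahedron n"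
      using interp(3) by blast
    obtain t where t: "\<And>u. u \<in> kuhn_tetrahedron n \<Longrightarrow> u + t \<in> K"
      using translates[OF n] by blast
    have "v + (t - w) \<in> K" if "v \<in> V" "0 < kuhn_hat (v - p)" for v
      using t[OF w[OF that]] by (simp add: algebra_simps)
    then show "\<exists>t. \<forall>v\<in>V. 0 < kuhn_hat (v - p) \<longrightarrow> v + t \<in> K" by blast
  qed (simp_all add: kuhn_hat_nonneg continuous_on_kuhn_hat)
  with V(2) show ?thesis by blast
qed

theorem theorem1p1:
  fixes x :: "nat \<Rightarrow> real^3" and K :: "(real^3) set"
  assumes "K = convex hull (\<Union>i\<in>{1..6}. {p + x i | p. p \<in> kuhn_tetrahedron i})"
  shows "{k + z | k z. k \<in> K \<and> z \<in> integer_lattice} = UNIV"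
proof -
  have pieces: "{p + x i | p. p \<in> kuhn_tetrahedron i} = (\<lambda>p. p + x i) ` kuhn_tetrahedron i" for i
    by blast
  have "compact (kuhn_tetrahedron i)" for i
    by (simp add: kuhn_tetrahedron_def finite_imp_compact_convex_hull)
  then have "compact K"
    unfolding assms pieces
    by (intro compact_convex_hull compact_UN compact_continuous_image continuous_intros) auto
  have "convex K" unfolding assms by simp
  have inK: "u + x n \<in> K" if "n \<in> {1..6}" "u \<in> kuhn_tetrahedron n" for n u
    unfolding assms using that by (intro hull_inc) blast
  have "\<exists>k z. q = k + z \<and> k \<in> K \<and> z \<in> integer_lattice" for q
  proof -
    let ?K = "(\<lambda>k. - q + k) ` K"
    have "\<exists>z\<in>integer_lattice. z \<in> ?K"
    proof (rule lattice_point_in_convex_with_kuhn_translates)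
      show "compact ?K" using \<open>compact K\<close> by (rule compact_translation)
      show "convex ?K" using \<open>convex K\<close> by (rule convex_translation)
      fix n :: nat assume "n \<in> {1..6}"
      then have "u + (x n - q) \<in> ?K" if "u \<in> kuhn_tetrahedron n" for u
        using inK[OF _ that] by (auto intro!: image_eqI[of _ _ "u + x n"])
      then show "\<exists>t. \<forall>u\<in>kuhn_tetrahedron n. u + t \<in> ?K" by blast
    qed
    then obtain k where "k \<in> K" "- q + k \<in> integer_lattice" by blast
    moreover from this(2) have "q - k \<in> integer_lattice"
      by (auto simp: integer_lattice_def dest: Ints_minus)
        (metis Ints_minus minus_diff_eq uminus_add_conv_diff)
    ultimately show ?thesis by (metis add.commute diff_add_cancel)
  qed
  then show ?thesis by blast
qed

end
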